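(* Let $A_k(x)=\sum_{\pi\in\mathfrak{S}_k}x^{\mathrm{des}(\pi)}$ be the Eulerian polynomials, and define the binomial-Eulerian polynomials by $\widetilde{A}_0(x)=1$ and $\widetilde{A}_n(x)=1+x\sum_{k=1}^{n}\binom{n}{k}A_k(x)$ for $n\ge 1$. Write $\widetilde{A}_n(x)=\sum_{k}\widetilde{A}(n,k)x^k$, with $\widetilde{A}(n,k)=0$ for $k<0$ or $k>n$. Then for every $n\ge 1$ and every integer $k$, $$\widetilde{A}(n+1,k)=(k+1)\widetilde{A}(n,k)+(n-k+2)\widetilde{A}(n,k-1)-n\,\widetilde{A}(n-1,k-1).$$
   Context: $\mathfrak{S}_m$ is the symmetric group on $[m]=\{1,\dots,m\}$; permutations are written as words $\pi(1)\pi(2)\cdots\pi(m)$. $\mathrm{des}(\pi)$ is the number of indices $i\in[m-1]$ with $\pi(i)>\pi(i+1)$. *)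

theory Defs
  imports "HOL-Combinatorics.Permutations" "HOL-Computational_Algebra.Polynomial"
begin

(* An element of the symmetric group on [m] is a function p with p permutes {1..m}
   (it is the identity outside {1..m}); its word is p 1, p 2, ..., p m. *)

definition des :: "nat \<Rightarrow> (nat \<Rightarrow> nat) \<Rightarrow> nat" where
  "des m p = card {i \<in> {1..<m}. p i > p (i + 1)}"

definition eulerian_poly :: "nat \<Rightarrow> int poly" where
  "eulerian_poly k = (\<Sum>p | p permutes {1..k}. monom 1 (des k p))"

definition binomial_eulerian_poly :: "nat \<Rightarrow> int poly" where
  "binomial_eulerian_poly n =
     (if n = 0 then 1
      else 1 + monom 1 1 * (\<Sum>k = 1..n. of_nat (n choose k) * eulerian_poly k))"

(* The coefficient of x^k for an integer index k.  Only negative k need a convention;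
   for k > n the coefficient vanishes by the lemma below. *)
definition binomial_eulerian :: "nat \<Rightarrow> int \<Rightarrow> int" where
  "binomial_eulerian n k =
     (if k < 0 then 0 else coeff (binomial_eulerian_poly n) (nat k))"

lemma des_less: "m \<ge> 1 \<Longrightarrow> des m p < m"
proof -
  assume m: "m \<ge> 1"
  have "des m p \<le> card {1..<m}"
    unfolding des_def by (rule card_mono) auto
  with m show ?thesis by simp
qed

lemma binomial_eulerian_eq_0:
  assumes "k > int n"
  shows "binomial_eulerian n k = 0"
proof -
  have e: "coeff (eulerian_poly j) i = 0" if "1 \<le> j" "j \<le> i" for i j
  proof -
    have "des j p \<noteq> i" for p
      using that des_less[of j p] by simp
    then show ?thesis
      by (simp add: eulerian_poly_def coeff_sum)
  qed
  obtain m where m: "nat k = Suc m" "n \<le> m"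
    using assms by (cases "nat k") auto
  have "coeff (of_nat (n choose j) * eulerian_poly j) m = 0" if "j \<in> {1..n}" for j
    using that e[of j m] m by (simp add: of_nat_poly)
  then show ?thesis
    using m by (simp add: binomial_eulerian_def binomial_eulerian_poly_def coeff_monom_mult coeff_sum)
qed

end

(* Inserting the letter n + 1 into a permutation p of [n] keeps the number of descents if it goes
   to the end of the word or into one of the des p descents, and raises it by one otherwise; hence
   A_{n+1} = (1 + n x) A_n + x (1 - x) A_n'.  Summing this against binom(n, k), Pascal's rule and
   k binom(n, k) = n binom(n, k) - n binom(n - 1, k) turn it into a recurrence for the binomial
   transform B_n of the A_k.  Since A~_n = 1 - x + x B_n, the claim is its coefficientwise form. *)
theory Submission
  imports Defs
begin

section \<open>Inserting the letter n + 1\<close>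

text \<open>The word of \<open>p \<circ> insert_cycle n j\<close> is that of \<open>p\<close> with \<open>n + 1\<close> inserted at position \<open>j\<close>.\<close>

definition insert_cycle :: "nat \<Rightarrow> nat \<Rightarrow> nat \<Rightarrow> nat" where
  "insert_cycle n j i =
     (if i = j then Suc n else if j < i \<and> i \<le> Suc n then i - 1 else i)"

lemma insert_cycle_permutes:
  assumes "j \<in> {1..Suc n}"
  shows "insert_cycle n j permutes {1..Suc n}"
proof (rule bij_imp_permutes)
  have "inj_on (insert_cycle n j) {1..Suc n}"
    using assms by (auto simp: inj_on_def insert_cycle_def split: if_splits)
  moreover have "insert_cycle n j ` {1..Suc n} \<subseteq> {1..Suc n}"
    using assms by (auto simp: insert_cycle_def)
  ultimately show "bij_betw (insert_cycle n j) {1..Suc n} {1..Suc n}"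
    by (simp add: bij_betw_def endo_inj_surj)
qed (use assms in \<open>auto simp: insert_cycle_def\<close>)

lemma insert_cycle_eq_Suc_iff:
  assumes "j \<in> {1..Suc n}"
  shows "insert_cycle n j i = Suc n \<longleftrightarrow> i = j"
  using assms by (auto simp: insert_cycle_def)

text \<open>The position j is recovered as the place where the composite takes the value n + 1,
  because p fixes n + 1; then the cycle cancels on the right. Surjectivity follows from injectivity
  by counting, n! * (n + 1) = (n + 1)!.\<close>

lemma bij_betw_insert_cycle:
  "bij_betw (\<lambda>(p, j). p \<circ> insert_cycle n j)
     ({p. p permutes {1..n}} \<times> {1..Suc n}) {q. q permutes {1..Suc n}}"
    (is "bij_betw ?f ?A ?B")
proof -
  have inj: "inj_on ?f ?A"
  proof (rule inj_onI, clarify)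
    fix p j p' j'
    assume p: "p permutes {1..n}" "p' permutes {1..n}"
      and j: "j \<in> {1..Suc n}" "j' \<in> {1..Suc n}"
      and eq: "p \<circ> insert_cycle n j = p' \<circ> insert_cycle n j'"
    have fixed: "p (Suc n) = Suc n" "p' (Suc n) = Suc n"
      using p by (auto intro: permutes_not_in)
    have "p' (insert_cycle n j' j) = p' (Suc n)"
      using fun_cong[OF eq, of j] fixed by (simp add: insert_cycle_def)
    then have "j = j'"
      using injD[OF permutes_inj[OF p(2)]] insert_cycle_eq_Suc_iff[OF j(2)] by blast
    moreover have "surj (insert_cycle n j)"
      using permutes_surj[OF insert_cycle_permutes[OF j(1)]] .
    ultimately show "p = p' \<and> j = j'"
      using eq by (metis fun.map_comp surj_iff comp_id)
  qed
  have "?f ` ?A \<subseteq> ?B"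
    using insert_cycle_permutes
    by (auto intro!: permutes_compose intro: permutes_subset simp del: One_nat_def)
  moreover have "card (?f ` ?A) = card ?B"
    using inj by (simp add: card_image card_cartesian_product card_permutations[OF refl])
  ultimately have "?f ` ?A = ?B"
    by (intro card_subset_eq finite_permutations) auto
  with inj show ?thesis
    by (simp add: bij_betw_def)
qed

section \<open>Descents after an insertion\<close>

lemma des_insert_end:
  assumes "p permutes {1..n}"
  shows "des (Suc n) (p \<circ> insert_cycle n (Suc n)) = des n p"
proof -
  have le: "p i \<le> n" if "i \<in> {1..n}" for i
    using permutes_in_image[OF assms, of i] that by simp
  have "p (Suc n) = Suc n"
    using assms by (auto intro: permutes_not_in)
  then have "{i \<in> {1..<Suc n}. (p \<circ> insert_cycle n (Suc n)) i > (p \<circ> insert_cycle n (Suc n)) (i + 1)}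
      = {i \<in> {1..<n}. p i > p (i + 1)}"
    using le by (fastforce simp: insert_cycle_def less_Suc_eq)
  then show ?thesis
    unfolding des_def by simp
qed

text \<open>The new letter exceeds both neighbours: it creates a descent at j, and at j - 1 an
  ascent replaces the old comparison of p (j - 1) with p j. For j = 1 nothing is removed, since 0 is
  not a position in the set.\<close>

lemma des_insert:
  assumes p: "p permutes {1..n}" and j: "j \<in> {1..n}"
  shows "des (Suc n) (p \<circ> insert_cycle n j)
           = Suc (card ({i \<in> {1..<n}. p i > p (i + 1)} - {j - 1}))"
proof -
  let ?D = "{i \<in> {1..<n}. p i > p (i + 1)}"
  let ?q = "p \<circ> insert_cycle n j"
  let ?E = "{i \<in> {1..<Suc n}. ?q i > ?q (i + 1)}"
  \<comment> \<open>\<open>h\<close> carries an old position to its new one: positions from j on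
    move one to the right. The value j is skipped, which leaves room for the new descent.\<close>
  define h where "h = (\<lambda>i. if i < j then i else Suc i)"
  have le: "p i \<le> n" if "i \<in> {1..n}" for i
    using permutes_in_image[OF p, of i] that by simp
  have fixed: "p (Suc n) = Suc n"
    using p by (auto intro: permutes_not_in)
  have "?E = insert j (h ` (?D - {j - 1}))"
  proof (intro equalityI subsetI)
    fix i assume i: "i \<in> ?E"
    consider "i + 1 < j" | "i + 1 = j" | "i = j" | "j < i" by linarith
    then show "i \<in> insert j (h ` (?D - {j - 1}))"
    proof cases
      case 1
      then have "i = h i" "i \<in> ?D - {j - 1}"
        using i j by (auto simp: h_def insert_cycle_def)
      then show ?thesis by blast
    next
      case 2
      then show ?thesis
        using i j fixed le[of i] by (auto simp: insert_cycle_def)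
    next
      case 4
      then have "i = h (i - 1)" "i - 1 \<in> ?D - {j - 1}"
        using i j by (auto simp: h_def insert_cycle_def)
      then show ?thesis by blast
    qed simp
  next
    fix i assume "i \<in> insert j (h ` (?D - {j - 1}))"
    then show "i \<in> ?E"
      using j fixed le[of j] by (auto simp: h_def insert_cycle_def less_Suc_eq_le)
  qed
  moreover have "j \<notin> h ` (?D - {j - 1})" "inj_on h (?D - {j - 1})"
    by (auto simp: h_def inj_on_def)
  ultimately show ?thesis
    by (simp add: des_def card_image)
qed

lemma sum_monom_des_insert:
  assumes p: "p permutes {1..n}"
  shows "(\<Sum>j = 1..Suc n. monom (1::int) (des (Suc n) (p \<circ> insert_cycle n j)))
    = of_nat (des n p + 1) * monom 1 (des n p) + of_nat (n - des n p) * monom 1 (des n p + 1)"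
proof -
  let ?D = "{i \<in> {1..<n}. p i > p (i + 1)}"
  let ?d = "des n p"
  have d: "card ?D = ?d" by (simp add: des_def)
  \<comment> \<open>The letter splits an old descent exactly when j - 1 is one, that is, when j is
    in the image of \<open>?D\<close> under \<open>Suc\<close>; this never happens for j =
    1.\<close>
  have "monom (1::int) (des (Suc n) (p \<circ> insert_cycle n j))
      = (if j \<in> Suc ` ?D then monom 1 ?d else monom 1 (?d + 1))" if j: "j \<in> {1..n}" for j
  proof (cases "j \<in> Suc ` ?D")
    case True
    then have "j - 1 \<in> ?D" by auto
    then have "Suc (card (?D - {j - 1})) = ?d"
      unfolding d[symmetric] by (intro card_Suc_Diff1) auto
    with True show ?thesis by (simp add: des_insert[OF p j])
  next
    case False
    then have "j - 1 \<notin> ?D" using j by (force simp: image_iff)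
    then have "?D - {j - 1} = ?D" by simp
    then have "des (Suc n) (p \<circ> insert_cycle n j) = ?d + 1"
      using des_insert[OF p j] d by (simp only: Suc_eq_plus1)
    then show ?thesis using False by (simp only: if_False)
  qed
  then have "(\<Sum>j = 1..n. monom (1::int) (des (Suc n) (p \<circ> insert_cycle n j)))
      = (\<Sum>j = 1..n. if j \<in> Suc ` ?D then monom 1 ?d else monom 1 (?d + 1))"
    by (intro sum.cong) auto
  also have "\<dots> = (\<Sum>j \<in> {1..n} \<inter> Suc ` ?D. monom 1 ?d) + (\<Sum>j \<in> {1..n} - Suc ` ?D. monom 1 (?d + 1))"
    by (subst sum.If_cases) (auto simp: Diff_eq Collect_mem_eq)
  also have "{1..n} \<inter> Suc ` ?D = Suc ` ?D" by auto
  also have "(\<Sum>j \<in> Suc ` ?D. monom (1::int) ?d) = of_nat ?d * monom 1 ?d"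
    using d by (simp add: card_image)
  also have "card ({1..n} - Suc ` ?D) = n - ?d"
    by (subst card_Diff_subset) (auto simp: card_image d[symmetric])
  then have "(\<Sum>j \<in> {1..n} - Suc ` ?D. monom (1::int) (?d + 1)) = of_nat (n - ?d) * monom 1 (?d + 1)"
    by simp
  finally show ?thesis
    by (simp add: des_insert_end[OF p, unfolded o_def] o_def algebra_simps)
qed

section \<open>The differential recurrence for Eulerian polynomials\<close>

lemma pderiv_sum: "pderiv (\<Sum>i\<in>A. f i) = (\<Sum>i\<in>A. pderiv (f i))"
  by (induction A rule: infinite_finite_induct) (simp_all add: pderiv_add)

text \<open>Grouping the permutations of [n + 1] by the p they arise from, a p with d descents
  contributes (d + 1) x^d + (n - d) x^(d+1). The part linear in d is d (x^d - x^(d+1)) = x (1 - x)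
  (x^d)', so the identity holds term by term.\<close>

lemma eulerian_poly_Suc:
  "eulerian_poly (Suc n) = (1 + of_nat n * monom 1 1) * eulerian_poly n
     + monom 1 1 * (1 - monom 1 1) * pderiv (eulerian_poly n)"
proof -
  let ?P = "{p. p permutes {1..n}}"
  have "eulerian_poly (Suc n)
      = (\<Sum>(p, j) \<in> ?P \<times> {1..Suc n}. monom 1 (des (Suc n) (p \<circ> insert_cycle n j)))"
    unfolding eulerian_poly_def
    by (subst sum.reindex_bij_betw[OF bij_betw_insert_cycle, symmetric])
       (simp add: case_prod_unfold)
  also have "\<dots> = (\<Sum>p\<in>?P. \<Sum>j = 1..Suc n. monom 1 (des (Suc n) (p \<circ> insert_cycle n j)))"
    by (simp only: sum.cartesian_product)
  also have "\<dots> = (\<Sum>p\<in>?P. (1 + of_nat n * monom 1 1) * monom 1 (des n p)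
      + monom 1 1 * (1 - monom 1 1) * pderiv (monom 1 (des n p)))"
  proof (rule sum.cong[OF refl])
    fix p assume "p \<in> ?P"
    then have p: "p permutes {1..n}" by simp
    obtain d where d: "d = des n p" by simp
    \<comment> \<open>This makes the natural number n - d agree with the integer difference. The
      case n = 0 is separate because \<open>des_less\<close> assumes m \<ge> 1.\<close>
    have "d \<le> n"
      using des_less[of n p] by (cases "n = 0") (auto simp: d des_def)
    have "of_nat (d + 1) * monom 1 d + of_nat (n - d) * monom 1 (d + 1)
      = (1 + of_nat n * monom 1 1) * monom 1 d
      + monom (1::int) 1 * (1 - monom 1 1) * pderiv (monom 1 d)"
      using \<open>d \<le> n\<close>
      by (cases d) (simp_all add: pderiv_monom of_nat_diff of_nat_poly mult_monom smult_monom
          add_monom diff_monom algebra_simps, simp add: poly_eq_iff)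
    then show "(\<Sum>j = 1..Suc n. monom 1 (des (Suc n) (p \<circ> insert_cycle n j)))
      = (1 + of_nat n * monom 1 1) * monom 1 (des n p)
      + monom (1::int) 1 * (1 - monom 1 1) * pderiv (monom 1 (des n p))"
      by (simp only: sum_monom_des_insert[OF p] d)
  qed
  finally show ?thesis
    by (simp add: eulerian_poly_def sum.distrib sum_distrib_left pderiv_sum)
qed

section \<open>Binomial transforms\<close>

definition binomial_transform :: "(nat \<Rightarrow> 'a::comm_semiring_1) \<Rightarrow> nat \<Rightarrow> 'a" where
  "binomial_transform a n = (\<Sum>k\<le>n. of_nat (n choose k) * a k)"

text \<open>Pascal's rule splits binom(n + 1, k + 1): the binom(n, k + 1) terms together with a 0
  give back the transform of a, the binom(n, k) terms that of the shifted sequence.\<close>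

lemma binomial_transform_Suc:
  "binomial_transform a (Suc n) = binomial_transform a n + binomial_transform (\<lambda>k. a (Suc k)) n"
proof -
  have "binomial_transform a (Suc n)
      = a 0 + (\<Sum>k\<le>n. of_nat (Suc n choose Suc k) * a (Suc k))"
    by (simp add: binomial_transform_def sum.atMost_Suc_shift del: sum.atMost_Suc binomial_Suc_Suc)
  also have "\<dots> = (a 0 + (\<Sum>k\<le>n. of_nat (n choose Suc k) * a (Suc k)))
      + binomial_transform (\<lambda>k. a (Suc k)) n"
    by (simp add: binomial_transform_def distrib_right distrib_left sum.distrib ac_simps)
  also have "a 0 + (\<Sum>k\<le>n. of_nat (n choose Suc k) * a (Suc k))
      = (\<Sum>k\<le>Suc n. of_nat (n choose k) * a k)"
    by (simp add: sum.atMost_Suc_shift del: sum.atMost_Suc)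
  \<comment> \<open>The extra summand at n + 1 vanishes because binom(n, n + 1) = 0.\<close>
  also have "\<dots> = binomial_transform a n"
    by (simp add: binomial_transform_def binomial_eq_0)
  finally show ?thesis .
qed

text \<open>Absorption, (k + 1) binom(n + 1, k + 1) = (n + 1) binom(n, k), yields the transform of
  the shifted sequence, which by \<open>binomial_transform_Suc\<close> is a difference of two
  transforms.\<close>

lemma binomial_transform_mult_index:
  fixes a :: "nat \<Rightarrow> 'a::comm_ring_1"
  shows "binomial_transform (\<lambda>k. of_nat k * a k) (Suc n)
    = of_nat (Suc n) * (binomial_transform a (Suc n) - binomial_transform a n)"
proof -
  have "binomial_transform (\<lambda>k. of_nat k * a k) (Suc n)
      = (\<Sum>k\<le>n. of_nat (Suc k * (Suc n choose Suc k)) * a (Suc k))"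
    by (simp add: binomial_transform_def sum.atMost_Suc_shift algebra_simps
        del: sum.atMost_Suc binomial_Suc_Suc)
  also have "\<dots> = of_nat (Suc n) * binomial_transform (\<lambda>k. a (Suc k)) n"
    unfolding Suc_times_binomial by (simp only: of_nat_mult mult.assoc sum_distrib_left binomial_transform_def)
  finally show ?thesis
    by (simp add: binomial_transform_Suc)
qed

lemma pderiv_binomial_transform:
  "pderiv (binomial_transform a n) = binomial_transform (\<lambda>k. pderiv (a k)) n"
  by (simp add: binomial_transform_def pderiv_sum pderiv_mult pderiv_of_nat)

section \<open>Recurrences for the transform and for the binomial-Eulerian polynomials\<close>

text \<open>One copy of B_n comes from Pascal's rule and one from the 1 in 1 + k x, hence the 2. The
  factor k in k x varies with the summation index, and removing it brings in B_(n-1).\<close>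

lemma binomial_transform_eulerian_poly_Suc:
  assumes "n \<ge> 1"
  shows "binomial_transform eulerian_poly (n + 1)
    = (2 + of_nat n * monom 1 1) * binomial_transform eulerian_poly n
      + monom 1 1 * (1 - monom 1 1) * pderiv (binomial_transform eulerian_poly n)
      - of_nat n * monom 1 1 * binomial_transform eulerian_poly (n - 1)"
proof -
  have "binomial_transform (\<lambda>k. eulerian_poly (Suc k)) n = binomial_transform eulerian_poly n
      + monom 1 1 * binomial_transform (\<lambda>k. of_nat k * eulerian_poly k) n
      + monom 1 1 * (1 - monom 1 1) * binomial_transform (\<lambda>k. pderiv (eulerian_poly k)) n"
    unfolding binomial_transform_def sum_distrib_left sum.distrib[symmetric]
    by (rule sum.cong) (simp_all only: eulerian_poly_Suc algebra_simps)
  moreover have "binomial_transform (\<lambda>k. of_nat k * eulerian_poly k) n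
      = of_nat n * (binomial_transform eulerian_poly n - binomial_transform eulerian_poly (n - 1))"
    using binomial_transform_mult_index[of eulerian_poly "n - 1"] assms by simp
  ultimately show ?thesis
    by (simp only: binomial_transform_Suc pderiv_binomial_transform Suc_eq_plus1[symmetric])
       (simp add: algebra_simps)
qed

text \<open>The transform also contains the k = 0 term A_0 = 1, and 1 - x corrects for it.\<close>

lemma binomial_eulerian_poly_eq:
  "binomial_eulerian_poly n = 1 - monom 1 1 + monom 1 1 * binomial_transform eulerian_poly n"
proof -
  have "eulerian_poly 0 = 1"
    by (simp add: eulerian_poly_def des_def)
  then have "binomial_transform eulerian_poly n
      = 1 + (\<Sum>k = 1..n. of_nat (n choose k) * eulerian_poly k)"
    by (simp add: binomial_transform_def atMost_atLeast0 sum.atLeast_Suc_atMost)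
  then show ?thesis
    by (simp add: binomial_eulerian_poly_def algebra_simps)
qed

text \<open>Differentiating the factor x of x B_n produces an extra (1 - x) x B_n, so the factor 2 +
  n x drops to 1 + (n + 1) x. The contributions of the summand 1 - x combine to 1 - x again.\<close>

lemma binomial_eulerian_poly_Suc:
  assumes "n \<ge> 1"
  shows "binomial_eulerian_poly (n + 1)
    = (1 + of_nat (n + 1) * monom 1 1) * binomial_eulerian_poly n
      + monom 1 1 * (1 - monom 1 1) * pderiv (binomial_eulerian_poly n)
      - of_nat n * monom 1 1 * binomial_eulerian_poly (n - 1)"
proof -
  have "pderiv (monom (1::int) 1) = 1"
    by (simp add: pderiv_monom)
  then show ?thesis
    by (simp only: binomial_eulerian_poly_eq binomial_transform_eulerian_poly_Suc[OF assms]
        pderiv_add pderiv_diff pderiv_mult pderiv_1) (simp add: algebra_simps)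
qed

theorem theorem2p1:
  fixes n :: nat and k :: int
  assumes "n \<ge> 1"
  shows "binomial_eulerian (n + 1) k =
           (k + 1) * binomial_eulerian n k
           + (int n - k + 2) * binomial_eulerian n (k - 1)
           - int n * binomial_eulerian (n - 1) (k - 1)"
proof (cases "k < 0")
  case True
  then show ?thesis by (simp add: binomial_eulerian_def)
next
  case False
  define x where "x = monom (1::int) 1"
  have shift: "coeff (x * f) i = (if i = 0 then 0 else coeff f (i - 1))" for f i
    by (simp add: x_def coeff_monom_mult)
  have scale: "coeff (of_nat m * f) i = int m * coeff f i" for m f i
    by (simp add: of_nat_poly)
  define m where "m = nat k"
  have "k = int m"
    using False by (simp add: m_def)
  have "binomial_eulerian_poly (n + 1) = binomial_eulerian_poly n
      + of_nat (n + 1) * (x * binomial_eulerian_poly n)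
      + x * pderiv (binomial_eulerian_poly n) - x * (x * pderiv (binomial_eulerian_poly n))
      - of_nat n * (x * binomial_eulerian_poly (n - 1))"
    unfolding binomial_eulerian_poly_Suc[OF assms] x_def by (simp only: algebra_simps)
  then have "coeff (binomial_eulerian_poly (n + 1)) m = coeff (binomial_eulerian_poly n) m
      + int (n + 1) * coeff (x * binomial_eulerian_poly n) m
      + coeff (x * pderiv (binomial_eulerian_poly n)) m
      - coeff (x * (x * pderiv (binomial_eulerian_poly n))) m
      - int n * coeff (x * binomial_eulerian_poly (n - 1)) m"
    by (simp only: coeff_add coeff_diff scale)
  then show ?thesis
    unfolding \<open>k = int m\<close>
    \<comment> \<open>The product x A~_n' contributes k times the k-th coefficient and x^2 A~_n'
      contributes k - 1 times the one before, so the latter gets n + 1 - (k - 1) = n - k + 2 in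
      total. The cases k = 0, k = 1 and k \<ge> 2 differ in which shifted indices fall below
      0.\<close>
    by (cases m; cases "m - 1")
       (simp_all add: binomial_eulerian_def shift coeff_pderiv algebra_simps nat_add_distrib)
qed

end
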